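(* Let $c\in[0,1)$, let $f:\mathbb{R}\to\mathbb{R}$ be continuous, and let $a>0$ be a real number such that $0\le f(t)\le a|t|$ for all $t\in\mathbb{R}$. If $$a^{2}<\frac{1+c}{2l},\qquad l=\max\left\{\frac{a}{a+c},\ \frac{a}{a+1-c}\right\},$$ then the origin is globally attracting for the difference equation $$x_{n+1}=cx_n+f(x_n-x_{n-1}),\qquad n=1,2,\ldots,$$ that is, for all real initial values $x_0,x_1$ the solution satisfies $\lim_{n\to\infty}x_n=0$.
   Context: A solution of the difference equation is a real sequence $\{x_n\}_{n\ge 0}$ satisfying it for all $n\ge 1$; it is determined by arbitrary real initial values $x_0,x_1$. The origin is globally attracting if every solution converges to $0$. *)

theory Defs
  imports "HOL-Analysis.Analysis"
begin

definition is_solution :: "real \<Rightarrow> (real \<Rightarrow> real) \<Rightarrow> (nat \<Rightarrow> real) \<Rightarrow> bool" where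
  "is_solution c f x \<longleftrightarrow> (\<forall>n\<ge>1. x (n + 1) = c * x n + f (x n - x (n - 1)))"

text \<open>The initial values \<open>x 0\<close> and \<open>x 1\<close> of a solution are unconstrained, so quantifying
  over all solutions is quantifying over all real initial values.\<close>

definition globally_attracting_origin :: "real \<Rightarrow> (real \<Rightarrow> real) \<Rightarrow> bool" where
  "globally_attracting_origin c f \<longleftrightarrow> (\<forall>x. is_solution c f x \<longrightarrow> x \<longlonglongrightarrow> 0)"

end

theory Submission
  imports Defs
begin

text \<open>
  Every solution satisfies the two-sided bound
  \<open>c * x n \<le> x (n + 1) \<le> c * x n + a * \<bar>x n - x (n - 1)\<bar>\<close>.
  If a solution stays negative, the left half makes \<open>\<bar>x n\<bar>\<close> decay geometrically. Otherwise
  it is nonnegative from some index on, and \<open>x (n + 1) \<ge> c * x n\<close> forbids drops by a factor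
  smaller than \<open>c\<close>. Three facts then force convergence to \<open>0\<close>.

  \<^item> Two steps contract across a drop: if \<open>x (n + 1) \<le> x n\<close>, then
    \<open>x (n + 2) \<le> \<kappa> * x n\<close> with a fixed \<open>\<kappa> < 1\<close> (\<open>two_step_contraction\<close>). This uses \<open>a < 1 + c\<close>.

  \<^item> A drop is followed by at most one rise before the next drop (\<open>drop_recurs\<close>). This uses
    \<open>a * (a - 1) \<le> c\<^sup>2\<close>.

  \<^item> A positive solution cannot rise forever (\<open>drop_exists\<close>). While it rises, the ratios
    \<open>r = x (n + 1) / x n\<close> satisfy \<open>r' \<le> c + a - a / r = r - p r / r\<close> with
    \<open>p r = r\<^sup>2 - (c + a) * r + a\<close>. If \<open>p\<close> is bounded away from \<open>0\<close> on \<open>r \<ge> 1\<close>, the ratios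
    lose a fixed amount in every step, which is absurd because they stay above \<open>1\<close>.

  So a first drop exists, drops recur, and the values from which the solution drops shrink
  by \<open>\<kappa>\<close> every few steps while bounding everything that comes after them
  (\<open>bounded_after_drop\<close>, \<open>drop_decay\<close>).

  The parameter condition says \<open>2 * a ^ 3 < (1 + c) * (a + c)\<close> and
  \<open>2 * a ^ 3 < (1 + c) * (a + 1 - c)\<close>. The first inequality yields \<open>a * (a - 1) < c\<^sup>2\<close>, which in
  turn yields \<open>a < 1 + c\<close>; the second yields the lower bound on \<open>p\<close>.
\<close>

section \<open>Consequences of the parameter condition\<close>

lemma cubic_parameter_bounds:
  fixes a c l :: real
  assumes "0 \<le> c" "c < 1" "a > 0"
    and l: "l = max (a / (a + c)) (a / (a + 1 - c))"
    and small: "a\<^sup>2 < (1 + c) / (2 * l)"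
  shows "2 * a ^ 3 < (1 + c) * (a + c)" "2 * a ^ 3 < (1 + c) * (a + 1 - c)"
proof -
  have pos: "a + c > 0" "a + 1 - c > 0" using assms by auto
  have bound: "2 * a ^ 3 < (1 + c) * s" if s: "s > 0" "a / s \<le> l" for s
  proof -
    have "0 < a / s" using s \<open>a > 0\<close> by simp
    then have "l > 0" using s by linarith
    then have "a\<^sup>2 * (2 * l) < 1 + c"
      using small by (simp add: pos_less_divide_eq)
    moreover have "a\<^sup>2 * (2 * (a / s)) \<le> a\<^sup>2 * (2 * l)"
      using s by (intro mult_left_mono) auto
    ultimately have "2 * a ^ 3 / s < 1 + c"
      by (simp add: power2_eq_square power3_eq_cube mult_ac)
    then show ?thesis using s by (simp add: pos_divide_less_eq)
  qed
  show "2 * a ^ 3 < (1 + c) * (a + c)" using pos l by (intro bound) auto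
  show "2 * a ^ 3 < (1 + c) * (a + 1 - c)" using pos l by (intro bound) auto
qed

text \<open>
  At the boundary \<open>a\<^sup>2 = a + c\<^sup>2\<close> one has \<open>2 * a ^ 3 = 2 * a + 2 * c\<^sup>2 + 2 * a * c\<^sup>2\<close>, which already
  exceeds \<open>(1 + c) * (a + c)\<close>.
\<close>

lemma drop_recurrence_parameter_bound:
  fixes a c :: real
  assumes "0 \<le> c" "c < 1" "a > 0" and cubic: "2 * a ^ 3 < (1 + c) * (a + c)"
  shows "a * (a - 1) < c\<^sup>2"
proof (rule ccontr)
  assume "\<not> ?thesis"
  then have ge: "a * a \<ge> a + c * c" by (simp add: algebra_simps power2_eq_square)
  then have "a * a \<ge> a * 1" using zero_le_square[of c] by linarith
  then have "a \<ge> 1" using \<open>a > 0\<close> by simp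
  have "a * (a * a) \<ge> a * (a + c * c)"
    using ge \<open>a > 0\<close> by (intro mult_left_mono) auto
  then have cube: "a ^ 3 \<ge> a + c * c + a * (c * c)"
    using ge by (simp add: power3_eq_cube algebra_simps)
  have "1 - c + 2 * (c * c) \<ge> 0" using assms zero_le_square[of c] by linarith
  then have "a * (1 - c + 2 * (c * c)) \<ge> 1 * (1 - c + 2 * (c * c))"
    using \<open>a \<ge> 1\<close> by (intro mult_right_mono) auto
  moreover have "1 - 2 * c + 3 * (c * c) = (1 - c) * (1 - c) + 2 * (c * c)"
    by (simp add: algebra_simps)
  then have "1 - 2 * c + 3 * (c * c) \<ge> 0"
    using zero_le_square[of "1 - c"] zero_le_square[of c] by linarith
  ultimately have "(1 + c) * (a + c) \<le> 2 * (a + c * c + a * (c * c))"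
    by (simp add: algebra_simps)
  also have "\<dots> \<le> 2 * a ^ 3" using cube by simp
  finally show False using cubic by simp
qed

lemma less_one_plus_if_drop_recurrence:
  fixes a c :: real
  assumes "0 \<le> c" "a * (a - 1) < c\<^sup>2"
  shows "a < 1 + c"
proof (rule ccontr)
  assume "\<not> ?thesis"
  then have "(1 + c) * c \<le> a * (a - 1)" using \<open>0 \<le> c\<close> by (intro mult_mono) auto
  then show False using assms by (simp add: algebra_simps power2_eq_square)
qed

text \<open>
  For \<open>a \<le> 1\<close> the bound comes from \<open>p r = (r - 1) * (r - a) + (1 - c) * r\<close>. For \<open>a > 1\<close> the
  cubic condition keeps \<open>1 - c\<close> above \<open>2 * (a - 1)\<close>, which makes the discriminant
  \<open>(c + a)\<^sup>2 - 4 * a\<close> negative.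
\<close>

lemma ratio_polynomial_bounded_below:
  fixes a c :: real
  assumes "0 \<le> c" "c < 1" "a > 0" and cubic: "2 * a ^ 3 < (1 + c) * (a + 1 - c)"
  obtains \<delta> where "\<delta> > 0" "\<And>r. r \<ge> 1 \<Longrightarrow> \<delta> \<le> r\<^sup>2 - (c + a) * r + a"
proof (cases "a \<le> 1")
  case True
  show ?thesis
  proof (rule that[of "1 - c"])
    fix r :: real assume "r \<ge> 1"
    have "0 \<le> (r - 1) * (r - a)" using \<open>r \<ge> 1\<close> True by (intro mult_nonneg_nonneg) auto
    moreover have "(1 - c) * 1 \<le> (1 - c) * r"
      using \<open>r \<ge> 1\<close> assms by (intro mult_left_mono) auto
    ultimately show "1 - c \<le> r\<^sup>2 - (c + a) * r + a"
      by (simp add: algebra_simps power2_eq_square)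
  qed (use assms in simp)
next
  case False
  define e where "e = 1 - c"
  define b where "b = a - 1"
  have e: "0 < e" "e \<le> 1" and b: "b > 0" using assms False by (auto simp: e_def b_def)
  have "0 \<le> e * (a + e)" using e \<open>a > 0\<close> by simp
  then have "(1 + c) * (a + 1 - c) \<le> 2 * (a + e)"
    by (simp add: e_def algebra_simps)
  then have "2 * a ^ 3 < 2 * (a + e)" by (rule order_less_le_trans[OF cubic])
  then have "a ^ 3 < a + e" by simp
  moreover have "a ^ 3 = a + 2 * b + 3 * (b * b) + b * b * b"
    by (simp add: b_def power3_eq_cube algebra_simps)
  moreover have "b * b > 0" "b * b * b > 0" using b by auto
  ultimately have eb: "2 * b < e" by linarith
  have "(c + a)\<^sup>2 - 4 * a = b * b + e * e - 2 * (e * b) - 4 * e"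
    by (simp add: e_def b_def power2_eq_square algebra_simps)
  moreover have "b * b \<le> e * e" using eb e b by (intro mult_mono) auto
  moreover have "e * e \<le> e * 1" using e by (intro mult_left_mono) auto
  moreover have "e * b > 0" using e b by simp
  ultimately have disc: "(c + a)\<^sup>2 < 4 * a" using e by linarith
  show ?thesis
  proof (rule that[of "a - (c + a)\<^sup>2 / 4"])
    fix r :: real
    have "0 \<le> (r - (c + a) / 2)\<^sup>2" by simp
    also have "\<dots> = r\<^sup>2 - (c + a) * r + (c + a)\<^sup>2 / 4"
      by (simp add: power2_eq_square field_simps)
    finally show "a - (c + a)\<^sup>2 / 4 \<le> r\<^sup>2 - (c + a) * r + a" by linarith
  qed (use disc in simp)
qed

section \<open>Nonnegative sequences with a two-sided difference bound\<close>

locale nonneg_difference_sequence =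
  fixes c a :: real and y :: "nat \<Rightarrow> real"
  assumes c_nonneg: "0 \<le> c" and c_less: "c < 1" and a_pos: "a > 0"
    and nonneg: "y k \<ge> 0"
    and lower: "c * y k \<le> y (Suc k)"
    and upper: "y (Suc (Suc k)) \<le> c * y (Suc k) + a * \<bar>y (Suc k) - y k\<bar>"
    and recurrence_bound: "a * (a - 1) < c\<^sup>2"
begin

text \<open>
  After a drop from \<open>v\<close> to \<open>u\<close>, where \<open>c * v \<le> u \<le> v\<close>, the bound on the next value is affine
  in \<open>u\<close>; its values at the ends \<open>u = v\<close> and \<open>u = c * v\<close> are \<open>v\<close> times the two terms here.
\<close>

definition \<kappa> :: real where
  "\<kappa> = max c (c\<^sup>2 + a * (1 - c))"

lemma kappa_nonneg: "\<kappa> \<ge> 0"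
  using c_nonneg by (simp add: \<kappa>_def)

lemma kappa_less_1: "\<kappa> < 1"
proof -
  have "a < 1 + c"
    using c_nonneg recurrence_bound by (rule less_one_plus_if_drop_recurrence)
  then have "a * (1 - c) < (1 + c) * (1 - c)"
    using c_less by (intro mult_strict_right_mono) auto
  then show ?thesis using c_less by (simp add: \<kappa>_def algebra_simps power2_eq_square)
qed

lemma two_step_contraction:
  assumes "y (Suc k) \<le> y k"
  shows "y (Suc (Suc k)) \<le> \<kappa> * y k"
proof -
  have w: "y (Suc (Suc k)) \<le> a * y k - (a - c) * y (Suc k)"
    using upper[of k] assms by (simp add: algebra_simps)
  have "a * y k - (a - c) * y (Suc k) \<le> max c (c\<^sup>2 + a * (1 - c)) * y k"
  proof (cases "c \<le> a")
    case True
    then have "(a - c) * (c * y k) \<le> (a - c) * y (Suc k)"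
      using lower by (intro mult_left_mono) auto
    then have "a * y k - (a - c) * y (Suc k) \<le> (c\<^sup>2 + a * (1 - c)) * y k"
      by (simp add: algebra_simps power2_eq_square)
    also have "\<dots> \<le> max c (c\<^sup>2 + a * (1 - c)) * y k"
      using nonneg by (intro mult_right_mono) auto
    finally show ?thesis .
  next
    case False
    then have "(c - a) * y (Suc k) \<le> (c - a) * y k"
      using assms by (intro mult_left_mono) auto
    then have "a * y k - (a - c) * y (Suc k) \<le> c * y k"
      by (simp add: algebra_simps)
    also have "\<dots> \<le> max c (c\<^sup>2 + a * (1 - c)) * y k"
      using nonneg by (intro mult_right_mono) auto
    finally show ?thesis .
  qed
  with w show ?thesis by (simp add: \<kappa>_def)
qed

text \<open>
  Let the sequence drop from \<open>v\<close> to \<open>u\<close> and then rise to \<open>w\<close>. The next value is at most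
  \<open>(c + a) * w - a * u\<close>, so it does not exceed \<open>w\<close> once \<open>(a + c - 1) * w \<le> a * u\<close>. This is
  clear if \<open>a + c \<le> 1\<close>. Otherwise the worst case is the largest possible \<open>w\<close> after the deepest possible drop \<open>u = c * v\<close>, and there
  the inequality is \<open>(1 - c) * v\<close> times \<open>a * (a - 1) \<le> c\<^sup>2\<close>.
\<close>

lemma drop_recurs:
  assumes drop: "y (Suc k) \<le> y k" and rise: "y (Suc k) < y (Suc (Suc k))"
  shows "y (Suc (Suc (Suc k))) \<le> y (Suc (Suc k))"
proof -
  define v u w where "v = y k" and "u = y (Suc k)" and "w = y (Suc (Suc k))"
  have z: "y (Suc (Suc (Suc k))) \<le> c * w + a * (w - u)"
    using upper[of "Suc k"] rise by (simp add: u_def w_def)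
  have nn: "v \<ge> 0" "u \<ge> 0" "w \<ge> 0" and uv: "c * v \<le> u"
    using nonneg lower by (auto simp: v_def u_def w_def)
  have w: "w \<le> a * v - (a - c) * u"
    using upper[of k] drop by (simp add: u_def v_def w_def algebra_simps)
  have "(a + c - 1) * w \<le> a * u"
  proof (cases "a + c \<le> 1")
    case True
    then have "(a + c - 1) * w \<le> 0" using nn by (intro mult_nonpos_nonneg) auto
    moreover have "0 \<le> a * u" using nn a_pos by simp
    ultimately show ?thesis by linarith
  next
    case False
    define q where "q = a\<^sup>2 + c - c\<^sup>2"
    have "c\<^sup>2 \<le> c" using c_nonneg c_less by (simp add: power2_eq_square mult_left_le)
    then have q: "q \<ge> 0" using zero_le_power2[of a] unfolding q_def by linarith
    have "(1 - c) * (a * (a - 1)) \<le> (1 - c) * c\<^sup>2"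
      using recurrence_bound c_less by (intro mult_left_mono) auto
    then have "(a + c - 1) * a \<le> q * c"
      by (simp add: q_def algebra_simps power2_eq_square)
    then have "(a + c - 1) * a * v \<le> q * c * v"
      using nn(1) by (rule mult_right_mono)
    also have "\<dots> \<le> q * u"
      using uv q by (simp add: mult.assoc mult_left_mono)
    finally have *: "(a + c - 1) * a * v \<le> q * u" .
    have "(a + c - 1) * w \<le> (a + c - 1) * (a * v - (a - c) * u)"
      using w False by (intro mult_left_mono) auto
    also have "\<dots> = (a + c - 1) * a * v - q * u + a * u"
      by (simp add: q_def algebra_simps power2_eq_square)
    finally show ?thesis using * by linarith
  qed
  then have "c * w + a * (w - u) \<le> w" by (simp add: algebra_simps)
  with z show ?thesis by (simp add: w_def)
qed

lemma bounded_after_drop: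
  assumes "y (Suc k) \<le> y k" "k \<le> m"
  shows "y m \<le> y k"
  using assms
proof (induction "m - k" arbitrary: k rule: less_induct)
  case less
  have contr: "y (Suc (Suc k)) \<le> y k"
    using two_step_contraction[OF less.prems(1)] kappa_less_1
      mult_right_mono[of \<kappa> 1 "y k"] nonneg[of k] by simp
  consider "m = k" | "m = Suc k" | "m \<ge> Suc (Suc k)" using less.prems(2) by linarith
  then show ?case
  proof cases
    case 3
    show ?thesis
    proof (cases "y (Suc (Suc k)) \<le> y (Suc k)")
      case True
      then have "y m \<le> y (Suc k)" using less.hyps[of "Suc k"] 3 by auto
      then show ?thesis using less.prems by linarith
    next
      case False
      then have "y (Suc (Suc (Suc k))) \<le> y (Suc (Suc k))"
        using drop_recurs less.prems(1) by simp
      then have "y m \<le> y (Suc (Suc k))" using less.hyps[of "Suc (Suc k)"] 3 by auto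
      then show ?thesis using contr by linarith
    qed
  qed (use less.prems in auto)
qed

text \<open>
  A drop at \<open>k\<close> is followed by a drop at \<open>k + 1\<close> or at \<open>k + 2\<close>. In the second case the
  contraction applies at once; in the first it applies to the drop at \<open>k\<close> or to the one at
  \<open>k + 1\<close>, according to where the third drop occurs.
\<close>

lemma drop_contracts:
  assumes drop: "y (Suc k) \<le> y k"
  shows "\<exists>k'. y (Suc k') \<le> y k' \<and> y k' \<le> \<kappa> * y k"
proof (cases "y (Suc (Suc k)) \<le> y (Suc k)")
  case False
  then show ?thesis using drop drop_recurs two_step_contraction by (metis not_le)
next
  case second: True
  show ?thesis
  proof (cases "y (Suc (Suc (Suc k))) \<le> y (Suc (Suc k))")
    case True
    then show ?thesis using two_step_contraction[OF drop] by blast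
  next
    case False
    then have "y (Suc (Suc (Suc (Suc k)))) \<le> y (Suc (Suc (Suc k)))"
      using drop_recurs second by simp
    moreover have "\<kappa> * y (Suc k) \<le> \<kappa> * y k"
      using drop kappa_nonneg by (rule mult_left_mono)
    then have "y (Suc (Suc (Suc k))) \<le> \<kappa> * y k"
      using two_step_contraction[OF second] by linarith
    ultimately show ?thesis by blast
  qed
qed

lemma drop_decay:
  assumes "y (Suc k) \<le> y k"
  shows "\<exists>k'. y (Suc k') \<le> y k' \<and> y k' \<le> \<kappa> ^ n * y k"
proof (induction n)
  case 0
  then show ?case using assms by auto
next
  case (Suc n)
  then obtain k' where k': "y (Suc k') \<le> y k'" "y k' \<le> \<kappa> ^ n * y k" by blast
  then obtain k'' where k'': "y (Suc k'') \<le> y k''" "y k'' \<le> \<kappa> * y k'"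
    using drop_contracts by blast
  moreover have "\<kappa> * y k' \<le> \<kappa> * (\<kappa> ^ n * y k)"
    using k'(2) kappa_nonneg by (rule mult_left_mono)
  ultimately have "y k'' \<le> \<kappa> ^ Suc n * y k" by (simp add: mult.assoc)
  with k'' show ?case by blast
qed

lemma tendsto_zero_if_drop:
  assumes "y (Suc k) \<le> y k"
  shows "y \<longlonglongrightarrow> 0"
proof (rule LIMSEQ_I)
  fix e :: real assume "e > 0"
  have "(\<lambda>n. \<kappa> ^ n * y k) \<longlonglongrightarrow> 0 * y k"
    using kappa_nonneg kappa_less_1 by (intro tendsto_mult LIMSEQ_realpow_zero tendsto_const) auto
  then have "eventually (\<lambda>n. \<kappa> ^ n * y k < e) sequentially"
    using \<open>e > 0\<close> by (intro order_tendstoD) auto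
  then obtain n where n: "\<kappa> ^ n * y k < e" by (auto dest: eventually_happens)
  obtain k' where k': "y (Suc k') \<le> y k'" "y k' \<le> \<kappa> ^ n * y k"
    using drop_decay[OF assms] by blast
  show "\<exists>K. \<forall>m\<ge>K. norm (y m - 0) < e"
  proof (intro exI allI impI)
    fix m assume "m \<ge> k'"
    then have "y m < e" using bounded_after_drop[OF k'(1)] k'(2) n by fastforce
    then show "norm (y m - 0) < e" using nonneg[of m] by simp
  qed
qed

text \<open>
  While the sequence rises, its successive ratios never exceed their initial value \<open>R\<close>, hence
  each of them is smaller than the previous one by at least \<open>\<delta> / R\<close>.
\<close>

lemma drop_exists:
  assumes \<delta>: "\<delta> > 0" "\<And>r. r \<ge> 1 \<Longrightarrow> \<delta> \<le> r\<^sup>2 - (c + a) * r + a"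
  shows "\<exists>k. y (Suc k) \<le> y k"
proof (rule ccontr)
  assume "\<not> ?thesis"
  then have rise: "y k < y (Suc k)" for k by (simp add: not_le)
  \<comment> \<open>The indices start at \<open>1\<close> because \<open>y 0\<close> may vanish.\<close>
  have pos: "y (Suc k) > 0" for k using rise[of k] nonneg[of k] by linarith
  define r where "r k = y (Suc (Suc k)) / y (Suc k)" for k
  have r1: "r k > 1" for k using rise[of "Suc k"] pos[of k] by (simp add: r_def)
  have step: "r (Suc k) \<le> r k - \<delta> / r k" for k
  proof -
    have "y (Suc (Suc (Suc k))) \<le> (c + a) * y (Suc (Suc k)) - a * y (Suc k)"
      using upper[of "Suc k"] rise[of "Suc k"] by (simp add: algebra_simps)
    then have "r (Suc k) \<le> ((c + a) * y (Suc (Suc k)) - a * y (Suc k)) / y (Suc (Suc k))"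
      using pos[of "Suc k"] unfolding r_def by (intro divide_right_mono) auto
    also have "\<dots> = c + a - a / r k"
      using pos[of k] pos[of "Suc k"] by (simp add: r_def field_simps)
    also have "\<dots> = r k - ((r k)\<^sup>2 - (c + a) * r k + a) / r k"
      using r1[of k] by (simp add: field_simps power2_eq_square)
    also have "\<dots> \<le> r k - \<delta> / r k"
      using \<delta>(2)[of "r k"] r1[of k] by (intro diff_left_mono divide_right_mono) auto
    finally show ?thesis .
  qed
  define R where "R = r 0"
  have "R > 1" using r1 by (simp add: R_def)
  have bound: "r k \<le> R - real k * (\<delta> / R)" for k
  proof (induction k)
    case 0
    then show ?case by (simp add: R_def)
  next
    case (Suc k)
    have "0 \<le> real k * (\<delta> / R)" using \<delta>(1) \<open>R > 1\<close> by simp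
    then have "r k \<le> R" using Suc by linarith
    then have "\<delta> / R \<le> \<delta> / r k" using r1[of k] \<delta>(1) by (intro divide_left_mono) auto
    then have "r (Suc k) \<le> R - real k * (\<delta> / R) - \<delta> / R" using step[of k] Suc by linarith
    then show ?case by (simp add: add_divide_distrib algebra_simps)
  qed
  have "\<delta> / R > 0" using \<delta>(1) \<open>R > 1\<close> by simp
  then obtain k where "R < real k * (\<delta> / R)"
    using reals_Archimedean3[of "\<delta> / R"] by blast
  then show False using bound[of k] r1[of k] by linarith
qed

end

section \<open>Global attraction\<close>

lemma tendsto_zero_if_eventually_negative:
  fixes c :: real and x :: "nat \<Rightarrow> real"
  assumes "0 \<le> c" "c < 1"
    and neg: "\<And>n. n \<ge> 1 \<Longrightarrow> x n < 0"
    and lower: "\<And>n. n \<ge> 1 \<Longrightarrow> c * x n \<le> x (n + 1)"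
  shows "x \<longlonglongrightarrow> 0"
proof -
  have geo: "c ^ n * x 1 \<le> x (Suc n)" for n
  proof (induction n)
    case 0
    then show ?case by simp
  next
    case (Suc n)
    then have "c * (c ^ n * x 1) \<le> c * x (Suc n)" using \<open>0 \<le> c\<close> by (rule mult_left_mono)
    also have "\<dots> \<le> x (Suc (Suc n))" using lower[of "Suc n"] by simp
    finally show ?case by (simp add: mult.assoc)
  qed
  have "(\<lambda>n. c ^ n * x 1) \<longlonglongrightarrow> 0 * x 1"
    using assms by (intro tendsto_mult LIMSEQ_realpow_zero tendsto_const) auto
  then have lim: "(\<lambda>n. norm (c ^ n * x 1)) \<longlonglongrightarrow> 0"
    by (intro tendsto_norm_zero) simp
  have "norm (x (Suc n)) \<le> norm (c ^ n * x 1)" for n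
    using geo[of n] neg[of "Suc n"] unfolding real_norm_def by linarith
  then have "eventually (\<lambda>n. norm (x (Suc n)) \<le> norm (c ^ n * x 1)) sequentially"
    by (intro always_eventually allI)
  then have "(\<lambda>n. x (Suc n)) \<longlonglongrightarrow> 0"
    using lim by (rule Lim_null_comparison)
  then show ?thesis by (rule LIMSEQ_imp_Suc)
qed

theorem theorem2p3:
  fixes c a l :: real and f :: "real \<Rightarrow> real"
  assumes "0 \<le> c" and "c < 1"
    and "continuous_on UNIV f"
    and "a > 0"
    and "\<And>t. 0 \<le> f t \<and> f t \<le> a * \<bar>t\<bar>"
    and "l = max (a / (a + c)) (a / (a + 1 - c))"
    and "a\<^sup>2 < (1 + c) / (2 * l)"
  shows "globally_attracting_origin c f"
  unfolding globally_attracting_origin_def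
proof (intro allI impI)
  fix x assume "is_solution c f x"
  then have eq: "x (n + 1) = c * x n + f (x n - x (n - 1))" if "n \<ge> 1" for n
    using that by (auto simp: is_solution_def)
  have lower: "c * x n \<le> x (n + 1)" if "n \<ge> 1" for n
    using eq[OF that] assms(5)[of "x n - x (n - 1)"] by linarith
  note cubic = cubic_parameter_bounds[OF assms(1,2,4,6,7)]
  show "x \<longlonglongrightarrow> 0"
  proof (cases "\<exists>N\<ge>1. x N \<ge> 0")
    case False
    show ?thesis
      by (rule tendsto_zero_if_eventually_negative[OF assms(1,2)]) (use False lower in force)+
  next
    case True
    then obtain N where N: "N \<ge> 1" "x N \<ge> 0" by blast
    define y where "y k = x (N + k)" for k
    have y_lower: "c * y k \<le> y (Suc k)" for k
      using lower[of "N + k"] N by (simp add: y_def)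
    have y_nonneg: "y k \<ge> 0" for k
    proof (induction k)
      case 0
      then show ?case using N by (simp add: y_def)
    next
      case (Suc k)
      then have "0 \<le> c * y k" using assms(1) by simp
      then show ?case using y_lower[of k] by linarith
    qed
    interpret nonneg_difference_sequence c a y
    proof
      fix k
      show "y (Suc (Suc k)) \<le> c * y (Suc k) + a * \<bar>y (Suc k) - y k\<bar>"
        using eq[of "N + Suc k"] assms(5)[of "y (Suc k) - y k"] by (simp add: y_def)
      show "a * (a - 1) < c\<^sup>2"
        using assms(1,2,4) cubic(1) by (rule drop_recurrence_parameter_bound)
    qed (use assms y_lower y_nonneg in auto)
    obtain \<delta> where "\<delta> > 0" "\<And>r. r \<ge> 1 \<Longrightarrow> \<delta> \<le> r\<^sup>2 - (c + a) * r + a"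
      by (rule ratio_polynomial_bounded_below[OF assms(1,2,4) cubic(2)]) metis
    then have "\<exists>k. y (Suc k) \<le> y k" by (rule drop_exists)
    then obtain k where "y (Suc k) \<le> y k" ..
    then have "y \<longlonglongrightarrow> 0" by (rule tendsto_zero_if_drop)
    then have "(\<lambda>k. x (k + N)) \<longlonglongrightarrow> 0"
      by (simp add: y_def[abs_def] add.commute[of N])
    then show ?thesis by (rule LIMSEQ_offset)
  qed
qed

end
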